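(* Let $K$ be an arbitrary field and let $p\in K\langle x_1,\dots,x_m\rangle$ be a multilinear polynomial evaluated on the matrix ring $M_2(K)$. Then either $\operatorname{Im} p=\{0\}$, or $\operatorname{Im} p=K$ (the set of scalar matrices), or $\operatorname{sl}_2(K)\subseteq \operatorname{Im} p$. Moreover, if $K=\mathbb{R}$, then $\operatorname{Im} p$ is either $\{0\}$, or $K$ (the set of scalar matrices), or $\operatorname{sl}_2(K)$, or $M_2(K)$.
   Context: $K\langle x_1,\dots,x_m\rangle$ is the free associative $K$-algebra on noncommuting variables $x_1,\dots,x_m$; its elements are called polynomials. A polynomial is multilinear of degree $m$ if it has the form $p(x_1,\dots,x_m)=\sum_{\sigma\in S_m}c_\sigma x_{\sigma(1)}\cdots x_{\sigma(m)}$ with $c_\sigma\in K$, where $S_m$ is the symmetric group on $m$ letters. $\operatorname{Im} p=\{p(a_1,\dots,a_m): a_1,\dots,a_m\in M_2(K)\}$ is the set of values of $p$ on $M_2(K)$. $\operatorname{sl}_2(K)$ is the set of matrices in $M_2(K)$ of trace $0$. $K$, viewed as a subset of $M_2(K)$, is the set of scalar matrices $\lambda I$, $\lambda\in K$. *)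

theory Defs
  imports "HOL-Analysis.Analysis" "HOL-Library.Poly_Mapping"
begin

text \<open>
  The free algebra is the monoid algebra of the free monoid, as supplied by
  \<^theory>\<open>HOL-Library.Poly_Mapping\<close>. That theory takes the product of monomials from the
  (not necessarily commutative) addition of exponents, so the free monoid is written additively:
  addition of words is concatenation.
\<close>

datatype 'x word_monoid = Word_Monoid (letters: "'x list")

instantiation word_monoid :: (type) monoid_add
begin

definition zero_word_monoid :: "'a word_monoid" where
  "0 = Word_Monoid []"

definition plus_word_monoid :: "'a word_monoid \<Rightarrow> 'a word_monoid \<Rightarrow> 'a word_monoid" where
  "u + v = Word_Monoid (letters u @ letters v)"

instance
  by standard (auto simp: zero_word_monoid_def plus_word_monoid_def)

end

text \<open>
  Variables are indexed by all natural numbers; the algebra on \<open>x\<^sub>1, \<dots>, x\<^sub>m\<close> is the subalgebra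
  of polynomials in which only the letters \<open>1, \<dots>, m\<close> occur.
\<close>

type_synonym 'k ncpoly = "nat word_monoid \<Rightarrow>\<^sub>0 'k"

definition nc_var :: "nat \<Rightarrow> 'k::field ncpoly" where
  "nc_var i = Poly_Mapping.single (Word_Monoid [i]) 1"

definition nc_const :: "'k::field \<Rightarrow> 'k ncpoly" where
  "nc_const c = Poly_Mapping.single 0 c"

definition free_algebra :: "nat \<Rightarrow> 'k::field ncpoly set" where
  "free_algebra m = {p. \<forall>w \<in> Poly_Mapping.keys p. set (letters w) \<subseteq> {1..m}}"

definition multilinear_poly :: "nat \<Rightarrow> 'k::field ncpoly \<Rightarrow> bool" where
  "multilinear_poly m p \<longleftrightarrow>
     (\<exists>c :: (nat \<Rightarrow> nat) \<Rightarrow> 'k.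
        p = (\<Sum>\<sigma> | \<sigma> permutes {1..m}. nc_const (c \<sigma>) * (\<Prod>i\<leftarrow>[1..<Suc m]. nc_var (\<sigma> i))))"

text \<open>
  The type class multiplication on \<^typ>\<open>'k^'n^'n\<close> is entrywise, so products of matrices are
  written with \<^term>\<open>(**)\<close>; \<^term>\<open>mat c\<close> is the scalar matrix with \<open>c\<close> on the diagonal.
\<close>

definition word_eval :: "(nat \<Rightarrow> 'k::field^'n^'n) \<Rightarrow> nat word_monoid \<Rightarrow> 'k^'n^'n" where
  "word_eval a w = foldr (**) (map a (letters w)) (mat 1)"

definition ncpoly_eval :: "(nat \<Rightarrow> 'k::field^'n^'n) \<Rightarrow> 'k ncpoly \<Rightarrow> 'k^'n^'n" where
  "ncpoly_eval a p = (\<Sum>w\<in>Poly_Mapping.keys p. mat (Poly_Mapping.lookup p w) ** word_eval a w)"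

definition ncpoly_image :: "'k::field ncpoly \<Rightarrow> ('k^2^2) set" where
  "ncpoly_image p = {ncpoly_eval a p | a. True}"

definition scalar_matrices :: "('k::field^2^2) set" where
  "scalar_matrices = {mat c | c. True}"

definition sl2 :: "('k::field^2^2) set" where
  "sl2 = {A. trace A = 0}"

text \<open>Evaluation at \<open>a\<close> is the algebra homomorphism that sends each variable \<open>x\<^sub>i\<close> to \<open>a i\<close>.\<close>

lemma mat_mult_commute:
  fixes A :: "'k::field^'n^'n"
  shows "mat c ** A = A ** mat c"
  by (simp add: vec_eq_iff matrix_matrix_mult_def mat_def if_distrib[of "\<lambda>x. x * _"]
      if_distrib[of "\<lambda>x. _ * x"] mult.commute cong: if_cong)

lemma mat_add: "mat (c + d) = (mat c + mat d :: 'k::field^'n^'n)"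
  by (simp add: vec_eq_iff mat_def)

lemma mat_mult: "mat (c * d) = (mat c ** mat d :: 'k::field^'n^'n)"
  by (simp add: vec_eq_iff matrix_matrix_mult_def mat_def if_distrib[of "\<lambda>x. x * _"]
      if_distrib[of "\<lambda>x. _ * x"] cong: if_cong)

lemma mat_zero: "mat 0 = (0 :: 'k::field^'n^'n)"
  by (simp add: vec_eq_iff mat_def)

lemma matrix_add_rdistrib: "(A + B) ** C = A ** C + (B ** C :: 'k::field^'n^'n)"
  by (simp add: vec_eq_iff matrix_matrix_mult_def distrib_right sum.distrib)

lemma word_eval_zero: "word_eval a 0 = mat 1"
  by (simp add: word_eval_def zero_word_monoid_def)

lemma word_eval_add: "word_eval a (u + v) = word_eval a u ** word_eval a v"
proof -
  have "foldr (**) (xs @ ys) (mat 1) = foldr (**) xs (mat 1) ** foldr (**) ys (mat 1)"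
    for xs ys :: "('a^'b^'b) list"
    by (induction xs) (simp_all add: matrix_mul_assoc)
  then show ?thesis
    unfolding word_eval_def plus_word_monoid_def by simp
qed

lemma ncpoly_eval_single:
  "ncpoly_eval a (Poly_Mapping.single w c) = mat c ** word_eval a w"
  by (simp add: ncpoly_eval_def mat_zero)

lemma ncpoly_eval_zero [simp]: "ncpoly_eval a 0 = 0"
  by (simp add: ncpoly_eval_def)

lemma ncpoly_eval_add: "ncpoly_eval a (p + q) = ncpoly_eval a p + ncpoly_eval a q"
  unfolding ncpoly_eval_def
  by (rule setsum_keys_plus_distrib) (simp_all add: mat_zero mat_add matrix_add_rdistrib)

lemma ncpoly_eval_sum: "ncpoly_eval a (sum f S) = (\<Sum>s\<in>S. ncpoly_eval a (f s))"
  by (induction S rule: infinite_finite_induct) (simp_all add: ncpoly_eval_add)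

lemma ncpoly_induct [case_names single add]:
  fixes p :: "'k::field ncpoly"
  assumes single: "\<And>w c. P (Poly_Mapping.single w c)"
    and add: "\<And>p q. P p \<Longrightarrow> P q \<Longrightarrow> P (p + q)"
  shows "P p"
proof (induction p rule: update_induct)
  case const
  show ?case using single[of 0 0] by simp
next
  case (update f w c)
  have "Poly_Mapping.update w c f = f + Poly_Mapping.single w c"
    using update(1)
    by (intro poly_mapping_eqI)
       (auto simp: lookup_update lookup_add lookup_single in_keys_iff when_def)
  then show ?case using add single update by metis
qed

lemma ncpoly_eval_mult: "ncpoly_eval a (p * q) = ncpoly_eval a p ** ncpoly_eval a q"
proof (induction p rule: ncpoly_induct)
  case (single u c)
  show ?case
  proof (induction q rule: ncpoly_induct)
    case (single v d)
    have "mat (c * d) ** (word_eval a u ** word_eval a v)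
        = (mat c ** word_eval a u) ** (mat d ** word_eval a v)"
      by (metis mat_mult mat_mult_commute matrix_mul_assoc)
    then show ?case
      by (simp add: mult_single ncpoly_eval_single word_eval_add)
  next
    case (add p q)
    then show ?case
      by (simp add: distrib_left ncpoly_eval_add matrix_add_ldistrib)
  qed
next
  case (add p q)
  then show ?case
    by (simp add: distrib_right ncpoly_eval_add matrix_add_rdistrib)
qed

lemma ncpoly_eval_const: "ncpoly_eval a (nc_const c) = mat c"
  by (simp add: nc_const_def ncpoly_eval_single word_eval_zero)

lemma ncpoly_eval_var: "ncpoly_eval a (nc_var i) = a i"
  by (simp add: nc_var_def ncpoly_eval_single word_eval_def)

lemma ncpoly_eval_prod_list:
  "ncpoly_eval a (prod_list ps) = foldr (**) (map (ncpoly_eval a) ps) (mat 1)"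
  by (induction ps)
     (simp_all add: ncpoly_eval_mult ncpoly_eval_const[of a 1, unfolded nc_const_def, simplified])

end

theory Submission
  imports Defs
begin

text \<open>
  The image of a multilinear polynomial is closed under scaling and under conjugation. If it
  consists of scalar matrices, it is therefore \<open>{0}\<close> or all of them. Suppose that it contains a
  nonscalar matrix. Two nonscalar matrices of size two with the same trace and determinant are
  conjugate (\<open>nonscalar_conjugate\<close>), so it is enough to find one matrix with prescribed invariants.

  Values at matrix units are under control because evaluation respects the grading in which
  \<open>e\<^sub>1\<^sub>2\<close> has degree \<open>1\<close> and \<open>e\<^sub>2\<^sub>1\<close> degree \<open>-1\<close>: such a value is diagonal, or a multiple of
  \<open>e\<^sub>1\<^sub>2\<close>, or a multiple of \<open>e\<^sub>2\<^sub>1\<close>. Conjugation by the flip of the two coordinates sends matrix units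
  to matrix units and preserves the parity of the degree. So if \<open>u\<close> is an assignment of matrix units
  and \<open>w\<close> is its flip, all assignments that choose each argument from \<open>u\<close> or from \<open>w\<close> have values in
  the same plane, that of the diagonal or that of the antidiagonal matrices. The lemma
  \<open>plane_subset_image\<close> shows that the image contains this whole plane once the values at \<open>u\<close> and
  \<open>w\<close> are independent.

  A nonscalar value yields a value \<open>c e\<^sub>1\<^sub>2 \<noteq> 0\<close> at matrix units. Its flip \<open>c e\<^sub>2\<^sub>1\<close> is independent of
  it, hence the image contains all antidiagonal matrices, and up to conjugation these are all
  nonscalar matrices of trace \<open>0\<close>. In characteristic two the scalar matrices have trace \<open>0\<close> as well; they are found by
  the same argument with a diagonal value \<open>diag \<alpha> \<beta>\<close> and its flip \<open>diag \<beta> \<alpha>\<close>, which are independent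
  unless \<open>\<alpha>\<^sup>2 = \<beta>\<^sup>2\<close>; in characteristic two this means \<open>\<alpha> = \<beta>\<close>, and then the value is itself scalar.

  Over the reals, suppose in addition that some value has nonzero trace. The diagonal argument, at
  matrix units with \<open>\<alpha> + \<beta> \<noteq> 0\<close>, again gives all scalar matrices. For a nonscalar matrix with nonzero trace the ratio
  \<open>r = det / trace\<^sup>2\<close> is what remains to be realized. The form \<open>det - r trace\<^sup>2\<close> takes both signs on
  the traceless matrices in the image. Changing the arguments one at a time leads from a positive to
  a negative value; after a perturbation that keeps trace and form away from \<open>0\<close> at all
  stations, one of the steps crosses a zero of the form with nonzero trace
  (\<open>pencil_zero\<close>, \<open>nonscalar_zero_in_image\<close>).
\<close>

section \<open>Two-by-two matrices\<close>

lemma mat_times_nth: "(mat c ** A) $ i $ j = c * (A :: 'k::field^'n^'n) $ i $ j"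
  by (simp add: matrix_matrix_mult_def mat_def if_distrib[of "\<lambda>x. x * _"] cong: if_cong)

lemma matrix2_eq_iff:
  "A = (B :: 'k^2^2) \<longleftrightarrow>
     A $ 1 $ 1 = B $ 1 $ 1 \<and> A $ 1 $ 2 = B $ 1 $ 2 \<and> A $ 2 $ 1 = B $ 2 $ 1 \<and> A $ 2 $ 2 = B $ 2 $ 2"
  by (auto simp: vec_eq_iff forall_2)

lemma matrix2_mult_nth: "(A ** B) $ i $ j = A $ i $ 1 * B $ 1 $ j + A $ i $ 2 * (B :: 'k::field^2^2) $ 2 $ j"
  by (simp add: matrix_matrix_mult_def sum_2)

lemma trace_2: "trace (A :: 'k::field^2^2) = A $ 1 $ 1 + A $ 2 $ 2"
  by (simp add: trace_def sum_2)

lemma mat2_nth: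
  "(mat c :: 'k::zero^2^2) $ 1 $ 1 = c" "(mat c :: 'k^2^2) $ 1 $ 2 = 0"
  "(mat c :: 'k^2^2) $ 2 $ 1 = 0" "(mat c :: 'k^2^2) $ 2 $ 2 = c"
  by (simp_all add: mat_def)

lemma scalar_matrices_iff:
  "A \<in> scalar_matrices \<longleftrightarrow> A $ 1 $ 2 = 0 \<and> A $ 2 $ 1 = 0 \<and> A $ 1 $ 1 = A $ 2 $ 2"
  by (auto simp: scalar_matrices_def matrix2_eq_iff mat2_nth)

definition matrix2 :: "'k \<Rightarrow> 'k \<Rightarrow> 'k \<Rightarrow> 'k \<Rightarrow> 'k^2^2" where
  "matrix2 a b c d = (\<chi> i j. if i = 1 then if j = 1 then a else b else if j = 1 then c else d)"

lemma matrix2_nth [simp]: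
  "matrix2 a b c d $ 1 $ 1 = a" "matrix2 a b c d $ 1 $ 2 = b"
  "matrix2 a b c d $ 2 $ 1 = c" "matrix2 a b c d $ 2 $ 2 = d"
  by (simp_all add: matrix2_def)

text \<open>
  A nonscalar matrix of size two has a cyclic vector, even over the field with two elements: one of
  \<open>e\<^sub>1\<close>, \<open>e\<^sub>2\<close>, \<open>e\<^sub>1 + e\<^sub>2\<close> is not an eigenvector. Its companion matrix, hence its conjugacy
  class, is determined by trace and determinant.
\<close>

lemma nonscalar_companion:
  fixes A :: "'k::field^2^2"
  assumes "A \<notin> scalar_matrices"
  obtains g where "invertible g" "A ** g = g ** matrix2 0 (- det A) 1 (trace A)"
proof -
  \<comment> \<open>The columns of \<open>g x y\<close> are \<open>v = (x, y)\<close> and \<open>A v\<close>.\<close>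
  define g where "g x y = matrix2 x (A $ 1 $ 1 * x + A $ 1 $ 2 * y) y (A $ 2 $ 1 * x + A $ 2 $ 2 * y)" for x y
  have "det (g 1 0) = A $ 2 $ 1" "det (g 0 1) = - A $ 1 $ 2"
    "det (g 1 1) = (A $ 2 $ 1 + A $ 2 $ 2) - (A $ 1 $ 1 + A $ 1 $ 2)"
    by (simp_all add: g_def det_2)
  then have "det (g 1 0) \<noteq> 0 \<or> det (g 0 1) \<noteq> 0 \<or> det (g 1 1) \<noteq> 0"
    using assms by (auto simp: scalar_matrices_iff)
  then obtain x y where "det (g x y) \<noteq> 0" by blast
  moreover have "A ** g x y = g x y ** matrix2 0 (- det A) 1 (trace A)"
    by (simp add: matrix2_eq_iff matrix2_mult_nth g_def det_2 trace_2 algebra_simps)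
  ultimately show ?thesis using that by (simp add: invertible_det_nz)
qed

lemma nonscalar_conjugate:
  fixes A B :: "'k::field^2^2"
  assumes "A \<notin> scalar_matrices" "B \<notin> scalar_matrices" "trace A = trace B" "det A = det B"
  obtains g h where "g ** h = mat 1" "h ** g = mat 1" "B = g ** A ** h"
proof -
  define C where "C = matrix2 0 (- det A) 1 (trace A)"
  obtain u where u: "invertible u" "A ** u = u ** C"
    using nonscalar_companion[OF assms(1)] C_def by auto
  obtain v where v: "invertible v" "B ** v = v ** C"
    using nonscalar_companion[OF assms(2)] C_def assms(3,4) by auto
  obtain u' where u': "u ** u' = mat 1" "u' ** u = mat 1" using u(1) by (auto simp: invertible_def)
  obtain v' where v': "v ** v' = mat 1" "v' ** v = mat 1" using v(1) by (auto simp: invertible_def)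
  have "(v ** u') ** (u ** v') = v ** (u' ** u) ** v'" "(u ** v') ** (v ** u') = u ** (v' ** v) ** u'"
    by (simp_all add: matrix_mul_assoc)
  then have "(v ** u') ** (u ** v') = mat 1" "(u ** v') ** (v ** u') = mat 1"
    by (simp_all add: u' v')
  moreover have "B = (v ** u') ** A ** (u ** v')"
  proof -
    have "(v ** u') ** A ** (u ** v') = v ** (u' ** (A ** u)) ** v'"
      by (simp add: matrix_mul_assoc)
    also have "u' ** (A ** u) = C"
      by (simp add: u(2) matrix_mul_assoc u')
    also have "v ** C ** v' = B ** (v ** v')"
      by (simp add: v(2)[symmetric] matrix_mul_assoc)
    finally show ?thesis by (simp add: v')
  qed
  ultimately show ?thesis using that by blast
qed

definition matrix_unit :: "'n \<Rightarrow> 'n \<Rightarrow> 'k::field^'n^'n" where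
  "matrix_unit i j = (\<chi> k l. if k = i \<and> l = j then 1 else 0)"

lemma matrix_unit_decomposition:
  "A = (\<Sum>(i, j)\<in>UNIV. mat (A $ i $ j) ** (matrix_unit i j :: 'k::field^'n^'n))"
proof -
  have "(\<Sum>(i, j)\<in>UNIV. (mat (A $ i $ j) ** (matrix_unit i j :: 'k^'n^'n)) $ k $ l) = A $ k $ l" for k l
  proof -
    have "(\<Sum>x\<in>UNIV. (case x of (i, j) \<Rightarrow> (mat (A $ i $ j) ** (matrix_unit i j :: 'k^'n^'n)) $ k $ l))
        = (\<Sum>x\<in>UNIV. if x = (k, l) then A $ k $ l else 0)"
      by (intro sum.cong) (auto simp: mat_times_nth matrix_unit_def split: if_splits)
    then show ?thesis by simp
  qed
  then show ?thesis by (simp add: vec_eq_iff sum_component case_prod_beta)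
qed

text \<open>
  The grading of the matrix algebra by the integers in which the diagonal has degree \<open>0\<close>, and the
  two off-diagonal matrix units have degrees \<open>1\<close> and \<open>-1\<close>.
\<close>

definition grade :: "2 \<Rightarrow> int" where
  "grade i = (if i = 1 then 0 else 1)"

definition homogeneous :: "int \<Rightarrow> 'k::field^2^2 \<Rightarrow> bool" where
  "homogeneous d A \<longleftrightarrow> (\<forall>i j. A $ i $ j \<noteq> 0 \<longrightarrow> grade j - grade i = d)"

lemma homogeneous_iff:
  "homogeneous d A \<longleftrightarrow> (d \<noteq> 0 \<longrightarrow> A $ 1 $ 1 = 0 \<and> A $ 2 $ 2 = 0) \<and>
     (d \<noteq> 1 \<longrightarrow> A $ 1 $ 2 = 0) \<and> (d \<noteq> - 1 \<longrightarrow> A $ 2 $ 1 = 0)"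
  by (auto simp: homogeneous_def grade_def forall_2)

lemma homogeneous_matrix_unit: "homogeneous (grade j - grade i) (matrix_unit i j)"
  by (auto simp: homogeneous_def matrix_unit_def)

lemma homogeneous_mat: "homogeneous 0 (mat c)"
  by (auto simp: homogeneous_def mat_def)

lemma homogeneous_mult:
  assumes "homogeneous d A" "homogeneous e B"
  shows "homogeneous (d + e) (A ** B)"
  unfolding homogeneous_def
proof (intro allI impI)
  fix i j assume "(A ** B) $ i $ j \<noteq> 0"
  then obtain k where "A $ i $ k * B $ k $ j \<noteq> 0"
    unfolding matrix2_mult_nth by (metis add_0)
  then have "A $ i $ k \<noteq> 0" "B $ k $ j \<noteq> 0" by auto
  then have "grade k - grade i = d" "grade j - grade k = e"
    using assms by (auto simp: homogeneous_def)
  then show "grade j - grade i = d + e" by simp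
qed

lemma homogeneous_sum:
  assumes "\<And>x. x \<in> X \<Longrightarrow> homogeneous d (f x)"
  shows "homogeneous d (\<Sum>x\<in>X. f x)"
  using assms by (induction X rule: infinite_finite_induct) (auto simp: homogeneous_iff)

lemma homogeneous_word_eval:
  assumes "\<And>i. homogeneous (d i) (a i)"
  shows "homogeneous (\<Sum>i\<leftarrow>xs. d i) (word_eval a (Word_Monoid xs))"
  by (induction xs) (simp_all add: word_eval_def homogeneous_mat homogeneous_mult assms)

section \<open>Evaluation of a multilinear polynomial\<close>

lemma word_eval_append:
  "word_eval a (Word_Monoid (xs @ ys)) = word_eval a (Word_Monoid xs) ** word_eval a (Word_Monoid ys)"
  using word_eval_add[of a "Word_Monoid xs" "Word_Monoid ys"] by (simp add: plus_word_monoid_def)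

lemma word_eval_Cons: "word_eval a (Word_Monoid (x # xs)) = a x ** word_eval a (Word_Monoid xs)"
  by (simp add: word_eval_def)

lemma word_eval_cong:
  assumes "\<And>x. x \<in> set xs \<Longrightarrow> a x = b x"
  shows "word_eval a (Word_Monoid xs) = word_eval b (Word_Monoid xs)"
  using assms by (induction xs) (simp_all add: word_eval_def)

lemma word_eval_linear:
  assumes "distinct xs" "j \<in> set xs"
  shows "word_eval (a(j := mat s ** X + mat t ** Y)) (Word_Monoid xs) =
     mat s ** word_eval (a(j := X)) (Word_Monoid xs) + mat t ** word_eval (a(j := Y)) (Word_Monoid xs)"
proof -
  obtain ys zs where xs: "xs = ys @ j # zs" using assms(2) by (meson split_list)
  have outer: "word_eval (a(j := Z)) (Word_Monoid ys) = word_eval a (Word_Monoid ys)"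
      "word_eval (a(j := Z)) (Word_Monoid zs) = word_eval a (Word_Monoid zs)" for Z
    using assms(1) xs by (auto intro!: word_eval_cong)
  have comm: "U ** ((mat s ** Z) ** V) = mat s ** (U ** (Z ** V))" for s and U Z V :: "'a^'b^'b"
    by (simp add: matrix_mul_assoc mat_mult_commute[of s U])
  show ?thesis
    by (simp add: xs word_eval_append word_eval_Cons outer matrix_add_rdistrib matrix_add_ldistrib comm)
qed

locale multilinear_polynomial =
  fixes m :: nat and p :: "'k::field ncpoly"
  assumes m_pos: "m \<ge> 1" and multilinear: "multilinear_poly m p"
begin

lemma eval_expansion:
  obtains c where "\<And>a :: nat \<Rightarrow> 'k^'n^'n. ncpoly_eval a p =
    (\<Sum>\<sigma> | \<sigma> permutes {1..m}. mat (c \<sigma>) ** word_eval a (Word_Monoid (map \<sigma> [1..<Suc m])))"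
proof -
  obtain c where p: "p = (\<Sum>\<sigma> | \<sigma> permutes {1..m}. nc_const (c \<sigma>) * (\<Prod>i\<leftarrow>[1..<Suc m]. nc_var (\<sigma> i)))"
    using multilinear by (auto simp: multilinear_poly_def)
  have "ncpoly_eval a p =
    (\<Sum>\<sigma> | \<sigma> permutes {1..m}. mat (c \<sigma>) ** word_eval a (Word_Monoid (map \<sigma> [1..<Suc m])))"
    for a :: "nat \<Rightarrow> 'k^'n^'n"
    by (subst p, simp only: ncpoly_eval_sum ncpoly_eval_mult ncpoly_eval_const ncpoly_eval_prod_list
        word_eval_def map_map o_def ncpoly_eval_var word_monoid.sel)
  then show ?thesis using that by blast
qed

lemma permuted_letters:
  assumes "\<sigma> permutes {1..m}"
  shows "distinct (map \<sigma> [1..<Suc m])" "set (map \<sigma> [1..<Suc m]) = {1..m}"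
  using permutes_image[OF assms] permutes_inj[OF assms]
  by (auto simp: distinct_map atLeastLessThanSuc_atLeastAtMost simp del: upt_Suc intro: inj_on_subset)

lemma eval_linear:
  assumes "j \<in> {1..m}"
  shows "ncpoly_eval (a(j := mat s ** X + mat t ** Y)) p =
    mat s ** ncpoly_eval (a(j := X)) p + mat t ** (ncpoly_eval (a(j := Y)) p :: 'k^'n^'n)"
proof -
  obtain c where c: "\<And>a :: nat \<Rightarrow> 'k^'n^'n. ncpoly_eval a p =
    (\<Sum>\<sigma> | \<sigma> permutes {1..m}. mat (c \<sigma>) ** word_eval a (Word_Monoid (map \<sigma> [1..<Suc m])))"
    using eval_expansion by blast
  have "word_eval (a(j := mat s ** X + mat t ** Y)) (Word_Monoid (map \<sigma> [1..<Suc m])) =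
     mat s ** word_eval (a(j := X)) (Word_Monoid (map \<sigma> [1..<Suc m])) +
     mat t ** word_eval (a(j := Y)) (Word_Monoid (map \<sigma> [1..<Suc m]))"
    if "\<sigma> permutes {1..m}" for \<sigma>
    by (rule word_eval_linear) (use permuted_letters[OF that] assms in auto)
  then have "ncpoly_eval (a(j := mat s ** X + mat t ** Y)) p =
    (\<Sum>\<sigma> | \<sigma> permutes {1..m}. mat (c \<sigma>) **
       (mat s ** word_eval (a(j := X)) (Word_Monoid (map \<sigma> [1..<Suc m])) +
        mat t ** word_eval (a(j := Y)) (Word_Monoid (map \<sigma> [1..<Suc m]))))"
    unfolding c by (intro sum.cong) auto
  then show ?thesis
    by (simp add: vec_eq_iff c mat_times_nth distrib_left sum.distrib sum_distrib_left mult.left_commute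
        del: upt_Suc)
qed

lemma eval_cong:
  assumes "\<And>i. i \<in> {1..m} \<Longrightarrow> a i = b i"
  shows "ncpoly_eval a p = (ncpoly_eval b p :: 'k^'n^'n)"
proof -
  obtain c where c: "\<And>a :: nat \<Rightarrow> 'k^'n^'n. ncpoly_eval a p =
    (\<Sum>\<sigma> | \<sigma> permutes {1..m}. mat (c \<sigma>) ** word_eval a (Word_Monoid (map \<sigma> [1..<Suc m])))"
    using eval_expansion by blast
  have "word_eval a (Word_Monoid (map \<sigma> [1..<Suc m])) = word_eval b (Word_Monoid (map \<sigma> [1..<Suc m]))"
    if "\<sigma> permutes {1..m}" for \<sigma>
    by (rule word_eval_cong) (use permuted_letters[OF that] assms in blast)
  then show ?thesis unfolding c by (intro sum.cong) auto
qed

lemma homogeneous_eval: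
  assumes "\<And>i. homogeneous (d i) (a i)"
  shows "homogeneous (\<Sum>i\<in>{1..m}. d i) (ncpoly_eval a p)"
proof -
  obtain c where c: "\<And>a :: nat \<Rightarrow> 'k^2^2. ncpoly_eval a p =
    (\<Sum>\<sigma> | \<sigma> permutes {1..m}. mat (c \<sigma>) ** word_eval a (Word_Monoid (map \<sigma> [1..<Suc m])))"
    using eval_expansion by blast
  have "homogeneous (\<Sum>i\<in>{1..m}. d i) (mat (c \<sigma>) ** word_eval a (Word_Monoid (map \<sigma> [1..<Suc m])))"
    if "\<sigma> permutes {1..m}" for \<sigma>
  proof -
    have "(\<Sum>i\<leftarrow>map \<sigma> [1..<Suc m]. d i) = (\<Sum>i\<in>{1..m}. d i)"
      using sum.distinct_set_conv_list[OF permuted_letters(1)[OF that], of d] permuted_letters(2)[OF that]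
      by (simp del: upt_Suc)
    then show ?thesis
      using homogeneous_mult[OF homogeneous_mat homogeneous_word_eval[of d a "map \<sigma> [1..<Suc m]"]] assms
      by (simp del: upt_Suc)
  qed
  then show ?thesis unfolding c by (intro homogeneous_sum) auto
qed

end

lemma word_eval_conjugate:
  assumes "h ** g = mat 1" "g ** h = mat 1"
  shows "word_eval (\<lambda>i. g ** a i ** h) (Word_Monoid xs) = g ** word_eval a (Word_Monoid xs) ** h"
proof (induction xs)
  case Nil
  then show ?case using assms by (simp add: word_eval_def)
next
  case (Cons x xs)
  have "(g ** a x ** h) ** (g ** W ** h) = g ** a x ** (h ** g) ** W ** h" for W
    by (simp add: matrix_mul_assoc)
  then have "(g ** a x ** h) ** (g ** W ** h) = g ** (a x ** W) ** h" for W
    by (simp add: assms(1) matrix_mul_assoc)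
  then show ?case using Cons by (simp add: word_eval_Cons)
qed

lemma eval_conjugate:
  fixes g h :: "'k::field^'n^'n"
  assumes "h ** g = mat 1" "g ** h = mat 1"
  shows "ncpoly_eval (\<lambda>i. g ** a i ** h) p = g ** ncpoly_eval a p ** h"
proof (induction p rule: ncpoly_induct)
  case (single w c)
  have "mat c ** (g ** W ** h) = g ** (mat c ** W) ** h" for W
    by (simp add: matrix_mul_assoc mat_mult_commute[of c g])
  then show ?case
    using word_eval_conjugate[OF assms, of a "letters w"] by (simp add: ncpoly_eval_single)
next
  case (add p q)
  then show ?case by (simp add: ncpoly_eval_add matrix_add_ldistrib matrix_add_rdistrib)
qed

lemma image_conjugate:
  assumes "(A :: 'k::field^2^2) \<in> ncpoly_image p" "h ** g = mat 1" "g ** h = mat 1"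
  shows "g ** A ** h \<in> ncpoly_image p"
proof -
  obtain a where "A = ncpoly_eval a p" using assms(1) by (auto simp: ncpoly_image_def)
  then have "g ** A ** h = ncpoly_eval (\<lambda>i. g ** a i ** h) p"
    using eval_conjugate[OF assms(2,3)] by metis
  then show ?thesis by (auto simp: ncpoly_image_def)
qed

context multilinear_polynomial
begin

lemma eval_scale:
  assumes "j \<in> {1..m}"
  shows "ncpoly_eval (a(j := mat s ** X)) p = mat s ** (ncpoly_eval (a(j := X)) p :: 'k^'n^'n)"
  using eval_linear[OF assms, of a s X 0 X] by (simp add: mat_zero)

lemma eval_add:
  assumes "j \<in> {1..m}"
  shows "ncpoly_eval (a(j := X + Y)) p =
    ncpoly_eval (a(j := X)) p + (ncpoly_eval (a(j := Y)) p :: 'k^'n^'n)"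
  using eval_linear[OF assms, of a 1 X 1 Y] by simp

lemma image_scale:
  assumes "A \<in> ncpoly_image p"
  shows "mat s ** A \<in> ncpoly_image p"
proof -
  obtain a where "A = ncpoly_eval a p" using assms by (auto simp: ncpoly_image_def)
  then have "mat s ** A = ncpoly_eval (a(1 := mat s ** a 1)) p"
    using eval_scale[of 1 a s "a 1"] m_pos by simp
  then show ?thesis by (auto simp: ncpoly_image_def)
qed

lemma zero_in_image: "0 \<in> ncpoly_image p"
  using image_scale[of "ncpoly_eval undefined p" 0] by (auto simp: ncpoly_image_def mat_zero)

lemma image_nonscalar:
  assumes "A \<in> ncpoly_image p" "A \<notin> scalar_matrices" "B \<notin> scalar_matrices"
    "trace A = trace B" "det A = det B"
  shows "B \<in> ncpoly_image p"
  using nonscalar_conjugate[OF assms(2-)] image_conjugate[OF assms(1)] by metis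

lemma eval_sum:
  assumes "j \<in> {1..m}" "finite X"
  shows "ncpoly_eval (a(j := (\<Sum>x\<in>X. mat (c x) ** f x))) p =
    (\<Sum>x\<in>X. mat (c x) ** (ncpoly_eval (a(j := f x)) p :: 'k^'n^'n))"
  using assms(2)
proof (induction X rule: finite_induct)
  case empty
  then show ?case using eval_scale[OF assms(1), of a 0 0] by (simp add: mat_zero fun_upd_def)
next
  case (insert x X)
  then show ?case
    using eval_linear[OF assms(1), of a "c x" "f x" 1 "\<Sum>x\<in>X. mat (c x) ** f x"] by (simp add: fun_upd_def)
qed

text \<open>
  By multilinear expansion the image spans the same subspace as the values at matrix units, so a
  linear functional that does not vanish on the image does not vanish at all of these values.
\<close>

lemma functional_nonzero_at_matrix_units:
  fixes \<phi> :: "'k^'n^'n \<Rightarrow> 'k"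
  assumes add: "\<And>A B. \<phi> (A + B) = \<phi> A + \<phi> B" and scale: "\<And>c A. \<phi> (mat c ** A) = c * \<phi> A"
    and nonzero: "\<phi> (ncpoly_eval a p) \<noteq> 0"
  obtains r s where "\<phi> (ncpoly_eval (\<lambda>i. matrix_unit (r i) (s i)) p) \<noteq> 0"
proof (rule ccontr)
  assume "\<not> thesis"
  then have zero: "\<phi> (ncpoly_eval (\<lambda>i. matrix_unit (r i) (s i)) p) = 0" for r s
    using that by blast
  have "\<phi> 0 = 0" using scale[of 0 0] by simp
  then have sum: "\<phi> (\<Sum>x\<in>X. f x) = (\<Sum>x\<in>X. \<phi> (f x))" for f and X :: "('n \<times> 'n) set"
    by (induction X rule: infinite_finite_induct) (simp_all add: add)
  \<comment> \<open>The first \<open>n\<close> arguments are arbitrary, the others are matrix units.\<close>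
  have "\<phi> (ncpoly_eval a p) = 0"
    if "n \<le> m" "\<And>i. n < i \<Longrightarrow> i \<le> m \<Longrightarrow> a i = matrix_unit (r i) (s i)" for n a r s
    using that
  proof (induction n arbitrary: a r s)
    case 0
    have "ncpoly_eval a p = ncpoly_eval (\<lambda>i. matrix_unit (r i) (s i)) p"
      by (rule eval_cong) (use 0 in auto)
    then show ?case using zero by simp
  next
    case (Suc n)
    have unit: "\<phi> (ncpoly_eval (a(Suc n := matrix_unit i j)) p) = 0" for i j
      by (rule Suc.IH[of _ "r(Suc n := i)" "s(Suc n := j)"]) (use Suc.prems in auto)
    have "ncpoly_eval a p = ncpoly_eval (a(Suc n := a (Suc n))) p" by simp
    also have "\<dots> = ncpoly_eval (a(Suc n := \<Sum>x\<in>UNIV. mat (a (Suc n) $ fst x $ snd x) **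
                matrix_unit (fst x) (snd x))) p"
      by (subst matrix_unit_decomposition) (simp add: case_prod_beta)
    also have "\<dots> = (\<Sum>x\<in>UNIV. mat (a (Suc n) $ fst x $ snd x) **
                ncpoly_eval (a(Suc n := matrix_unit (fst x) (snd x))) p)"
      by (rule eval_sum) (use Suc.prems in auto)
    finally show ?case by (simp add: sum scale unit)
  qed
  from this[of m a] nonzero show False by auto
qed

section \<open>Planes swept out by multilinear families\<close>

lemma eval_cube_expansion:
  assumes "finite D" "D \<subseteq> {1..m}"
  shows "ncpoly_eval (override_on u (\<lambda>i. u i + w i) D) p =
    (\<Sum>R\<in>Pow D. (ncpoly_eval (override_on u w R) p :: 'k^'n^'n))"
  using assms
proof (induction D arbitrary: u rule: finite_induct)
  case empty
  then show ?case by simp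
next
  case (insert j D)
  define u' where "u' = u(j := w j)"
  have upd: "override_on u (\<lambda>i. u i + w i) (insert j D)
      = (override_on u (\<lambda>i. u i + w i) D)(j := u j + w j)"
    by (auto simp: override_on_def)
  have keep: "(override_on u (\<lambda>i. u i + w i) D)(j := u j) = override_on u (\<lambda>i. u i + w i) D"
    using insert.hyps by (auto simp: override_on_def)
  have change: "(override_on u (\<lambda>i. u i + w i) D)(j := w j) = override_on u' (\<lambda>i. u' i + w i) D"
    using insert.hyps by (auto simp: override_on_def u'_def)
  have "ncpoly_eval (override_on u (\<lambda>i. u i + w i) (insert j D)) p =
      (\<Sum>R\<in>Pow D. ncpoly_eval (override_on u w R) p) + (\<Sum>R\<in>Pow D. ncpoly_eval (override_on u' w R) p)"
    unfolding upd using insert.prems insert.IH by (subst eval_add) (auto simp: keep change)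
  also have "(\<Sum>R\<in>Pow D. ncpoly_eval (override_on u' w R) p) =
      (\<Sum>R\<in>insert j ` Pow D. ncpoly_eval (override_on u w R) p)"
  proof (subst sum.reindex)
    show "inj_on (insert j) (Pow D)" using insert.hyps by (auto simp: inj_on_def)
    show "(\<Sum>R\<in>Pow D. ncpoly_eval (override_on u' w R) p) =
      sum ((\<lambda>R. ncpoly_eval (override_on u w R) p) \<circ> insert j) (Pow D)"
      by (intro sum.cong refl) (auto simp: override_on_def u'_def intro!: eval_cong)
  qed
  also have "(\<Sum>R\<in>Pow D. ncpoly_eval (override_on u w R) p) + \<dots> =
      (\<Sum>R\<in>Pow (insert j D). ncpoly_eval (override_on u w R) p)"
    unfolding Pow_insert using insert.hyps by (intro sum.union_disjoint[symmetric]) auto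
  finally show ?case .
qed

end

text \<open>
  For \<open>(k, l) = (1, 2)\<close> this is the plane of diagonal matrices, for \<open>(k, l) = (2, 1)\<close> the plane of
  antidiagonal ones.
\<close>

definition coordinate_plane :: "2 \<Rightarrow> 2 \<Rightarrow> ('k::field^2^2) set" where
  "coordinate_plane k l = {A. A $ 1 $ l = 0 \<and> A $ 2 $ k = 0}"

context multilinear_polynomial
begin

text \<open>
  The assignments \<open>override_on u w R\<close> are the vertices of a cube with opposite corners \<open>u\<close> and \<open>w\<close>.
  If a vertex other than these corners has a nonzero value, then this value is independent of that at
  \<open>u\<close> or of that at \<open>w\<close>, and a smaller cube will do. If there is no such vertex, then in the
  multilinear expansion of a value at \<open>u\<^sub>i + w\<^sub>i\<close> only the two corners survive; their coefficients
  are made arbitrary by rescaling the two summands in one coordinate.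
\<close>

lemma plane_subset_image:
  fixes u w :: "nat \<Rightarrow> 'k^2^2"
  assumes "k \<noteq> l"
    and "\<And>R. ncpoly_eval (override_on u w R) p \<in> coordinate_plane k l"
    and "ncpoly_eval u p $ 1 $ k * ncpoly_eval w p $ 2 $ l \<noteq>
         ncpoly_eval u p $ 2 $ l * ncpoly_eval w p $ 1 $ k"
  shows "coordinate_plane k l \<subseteq> ncpoly_image p"
  using assms(2-)
proof (induction "card {i \<in> {1..m}. u i \<noteq> w i}" arbitrary: u w rule: less_induct)
  case less
  define D where "D = {i \<in> {1..m}. u i \<noteq> w i}"
  let ?F = "\<lambda>a. ncpoly_eval a p :: 'k^2^2"
  have D: "finite D" "D \<subseteq> {1..m}" by (auto simp: D_def)
  have w: "?F (override_on u w D) = ?F w"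
    by (rule eval_cong) (auto simp: D_def override_on_def)
  have "D \<noteq> {}"
    using less.prems(2) w by (auto simp: mult.commute)
  show ?case
  proof (cases "\<exists>R. R \<subset> D \<and> R \<noteq> {} \<and> ?F (override_on u w R) \<noteq> 0")
    case True
    then obtain R where R: "R \<subset> D" "R \<noteq> {}" "?F (override_on u w R) \<noteq> 0" by blast
    define v where "v = override_on u w R"
    have v_plane: "?F v $ 1 $ l = 0" "?F v $ 2 $ k = 0"
      using less.prems(1)[of R] by (auto simp: v_def coordinate_plane_def)
    have kl: "k = 1 \<and> l = 2 \<or> k = 2 \<and> l = 1" using exhaust_2[of k] exhaust_2[of l] assms(1) by auto
    have "?F v \<noteq> 0" using R v_def by simp
    then have v: "?F v $ 1 $ k \<noteq> 0 \<or> ?F v $ 2 $ l \<noteq> 0"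
      using v_plane kl by (auto simp: matrix2_eq_iff)
    have fin: "finite {i \<in> {1..m}. u i \<noteq> w i}" by simp
    have "?F u $ 1 $ k * ?F v $ 2 $ l \<noteq> ?F u $ 2 $ l * ?F v $ 1 $ k \<or>
          ?F v $ 1 $ k * ?F w $ 2 $ l \<noteq> ?F v $ 2 $ l * ?F w $ 1 $ k"
    proof (rule ccontr)
      assume "\<not> ?thesis"
      then have "?F v $ 1 $ k * (?F u $ 1 $ k * ?F w $ 2 $ l - ?F u $ 2 $ l * ?F w $ 1 $ k) = 0"
          "?F v $ 2 $ l * (?F u $ 1 $ k * ?F w $ 2 $ l - ?F u $ 2 $ l * ?F w $ 1 $ k) = 0"
        by algebra+
      then show False using v less.prems(2) by auto
    qed
    then show ?thesis
    proof
      assume indep: "?F u $ 1 $ k * ?F v $ 2 $ l \<noteq> ?F u $ 2 $ l * ?F v $ 1 $ k"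
      have "{i \<in> {1..m}. u i \<noteq> v i} \<subset> {i \<in> {1..m}. u i \<noteq> w i}"
        using R by (auto simp: D_def v_def override_on_def)
      then have "card {i \<in> {1..m}. u i \<noteq> v i} < card {i \<in> {1..m}. u i \<noteq> w i}"
        using fin by (rule psubset_card_mono[rotated])
      moreover have "override_on u v Q = override_on u w (R \<inter> Q)" for Q
        by (auto simp: v_def override_on_def)
      ultimately show ?thesis using less.hyps[of u v] less.prems(1) indep by simp
    next
      assume indep: "?F v $ 1 $ k * ?F w $ 2 $ l \<noteq> ?F v $ 2 $ l * ?F w $ 1 $ k"
      have "{i \<in> {1..m}. v i \<noteq> w i} \<subset> {i \<in> {1..m}. u i \<noteq> w i}"
        using R by (auto simp: D_def v_def override_on_def)
      then have "card {i \<in> {1..m}. v i \<noteq> w i} < card {i \<in> {1..m}. u i \<noteq> w i}"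
        using fin by (rule psubset_card_mono[rotated])
      moreover have "override_on v w Q = override_on u w (R \<union> Q)" for Q
        by (auto simp: v_def override_on_def)
      ultimately show ?thesis using less.hyps[of v w] less.prems(1) indep by simp
    qed
  next
    case False
    obtain j where j: "j \<in> D" "j \<in> {1..m}" using \<open>D \<noteq> {}\<close> D by blast
    have combination: "mat s ** ?F u + mat t ** ?F w \<in> ncpoly_image p" for s t
    proof -
      define u' where "u' = u(j := mat s ** u j)"
      define w' where "w' = w(j := mat t ** w j)"
      define G where "G R = ?F (override_on u w R)" for R
      have G: "G {} = ?F u" "G D = ?F w" using w by (simp_all add: G_def)
      have interior: "G R = 0" if "R \<in> Pow D - {{}, D}" for R
        using that False unfolding G_def by blast
      have vertex: "?F (override_on u' w' R) = mat (if j \<in> R then t else s) ** G R" for R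
      proof -
        have "override_on u' w' R =
            (override_on u w R)(j := mat (if j \<in> R then t else s) ** override_on u w R j)"
          by (auto simp: u'_def w'_def override_on_def)
        then show ?thesis
          using eval_scale[OF j(2), of "override_on u w R" _ "override_on u w R j"] by (simp add: G_def)
      qed
      have "?F (override_on u' (\<lambda>i. u' i + w' i) D) = (\<Sum>R\<in>Pow D. ?F (override_on u' w' R))"
        using D by (rule eval_cube_expansion)
      also have "\<dots> = (\<Sum>R\<in>Pow D. mat (if j \<in> R then t else s) ** G R)"
        by (intro sum.cong refl vertex)
      also have "\<dots> = (\<Sum>R\<in>{{}, D}. mat (if j \<in> R then t else s) ** G R)"
        using D interior by (intro sum.mono_neutral_right) auto
      also have "\<dots> = mat s ** ?F u + mat t ** ?F w"
        using \<open>D \<noteq> {}\<close> j by (simp add: G)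
      finally show ?thesis unfolding ncpoly_image_def mem_Collect_eq by metis
    qed
    show ?thesis
    proof
      fix B :: "'k^2^2" assume B: "B \<in> coordinate_plane k l"
      define \<delta> where "\<delta> = ?F u $ 1 $ k * ?F w $ 2 $ l - ?F u $ 2 $ l * ?F w $ 1 $ k"
      have \<delta>: "\<delta> \<noteq> 0" using less.prems(2) by (simp add: \<delta>_def)
      \<comment> \<open>Cramer's rule in the basis \<open>?F u\<close>, \<open>?F w\<close> of the plane.\<close>
      define s where "s = (B $ 1 $ k * ?F w $ 2 $ l - B $ 2 $ l * ?F w $ 1 $ k) / \<delta>"
      define t where "t = (?F u $ 1 $ k * B $ 2 $ l - ?F u $ 2 $ l * B $ 1 $ k) / \<delta>"
      have "B $ 1 $ k = s * ?F u $ 1 $ k + t * ?F w $ 1 $ k" "B $ 2 $ l = s * ?F u $ 2 $ l + t * ?F w $ 2 $ l"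
        using \<delta> by (simp_all add: s_def t_def field_simps) (simp_all add: \<delta>_def algebra_simps)
      moreover have "?F u \<in> coordinate_plane k l" "?F w \<in> coordinate_plane k l"
        using less.prems(1)[of "{}"] less.prems(1)[of D] w by auto
      ultimately have "B = mat s ** ?F u + mat t ** ?F w"
        using B assms(1) exhaust_2[of k] exhaust_2[of l]
        by (auto simp: matrix2_eq_iff mat_times_nth coordinate_plane_def)
      then show "B \<in> ncpoly_image p" using combination by simp
    qed
  qed
qed

end

section \<open>Nonscalar values\<close>

definition flip :: "'k::field^2^2" where
  "flip = matrix2 0 1 1 0"

lemma flip_mult_flip: "flip ** flip = mat 1"
  by (simp add: flip_def matrix2_eq_iff matrix2_mult_nth mat2_nth)

lemma flip_conjugate_nth:
  "(flip ** A ** flip) $ 1 $ 1 = A $ 2 $ 2" "(flip ** A ** flip) $ 1 $ 2 = A $ 2 $ 1"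
  "(flip ** A ** flip) $ 2 $ 1 = A $ 1 $ 2" "(flip ** A ** flip) $ 2 $ 2 = A $ 1 $ 1"
  by (simp_all add: flip_def matrix2_mult_nth)

lemma homogeneous_flip: "homogeneous d A \<Longrightarrow> homogeneous (- d) (flip ** A ** flip)"
  by (auto simp: homogeneous_iff flip_conjugate_nth)

context multilinear_polynomial
begin

text \<open>
  Conjugation by \<open>flip\<close> renames the indices \<open>1\<close> and \<open>2\<close>, which negates the degree of a matrix unit
  and preserves its parity. So on the cube between an assignment of matrix units and its flip, the
  values are either all diagonal or all antidiagonal.
\<close>

lemma homogeneous_flip_cube:
  fixes r s :: "nat \<Rightarrow> 2"
  defines "u \<equiv> \<lambda>i. matrix_unit (r i) (s i) :: 'k^2^2"
  obtains d where "homogeneous d (ncpoly_eval u p :: 'k^2^2)"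
    "\<And>R. \<exists>e. even (e - d) \<and> homogeneous e (ncpoly_eval (override_on u (\<lambda>i. flip ** u i ** flip) R) p)"
proof -
  define f where "f i = grade (s i) - grade (r i)" for i
  have u: "homogeneous (f i) (u i :: 'k^2^2)" for i
    unfolding u_def f_def by (rule homogeneous_matrix_unit)
  have "\<exists>e. even (e - (\<Sum>i\<in>{1..m}. f i)) \<and>
      homogeneous e (ncpoly_eval (override_on u (\<lambda>i. flip ** u i ** flip) R) p :: 'k^2^2)" for R
  proof -
    define h where "h i = (if i \<in> R then - f i else f i)" for i
    have "homogeneous (h i) (override_on u (\<lambda>i. flip ** u i ** flip) R i :: 'k^2^2)" for i
      using u homogeneous_flip[OF u] by (simp add: h_def override_on_def)
    then have "homogeneous (\<Sum>i\<in>{1..m}. h i)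
        (ncpoly_eval (override_on u (\<lambda>i. flip ** u i ** flip) R) p :: 'k^2^2)"
      by (rule homogeneous_eval)
    moreover have "even ((\<Sum>i\<in>{1..m}. h i) - (\<Sum>i\<in>{1..m}. f i))"
      unfolding sum_subtractf[symmetric] by (rule dvd_sum) (simp add: h_def)
    ultimately show ?thesis by blast
  qed
  then show ?thesis by (rule that[OF homogeneous_eval[OF u]])
qed

lemma eval_flip: "ncpoly_eval (\<lambda>i. flip ** u i ** flip) p = flip ** (ncpoly_eval u p) ** (flip :: 'k^2^2)"
  by (rule eval_conjugate[OF flip_mult_flip flip_mult_flip])

text \<open>
  Some conjugate of a nonscalar matrix has a nonzero upper right entry, so some assignment of matrix
  units has degree \<open>1\<close> and the value \<open>c e\<^sub>1\<^sub>2\<close>, \<open>c \<noteq> 0\<close>. Its flip has the value \<open>c e\<^sub>2\<^sub>1\<close>, and these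
  two are independent in the plane of antidiagonal matrices.
\<close>

lemma antidiagonal_subset_image:
  assumes "A \<in> ncpoly_image p" "A \<notin> scalar_matrices"
  shows "coordinate_plane 2 1 \<subseteq> ncpoly_image p"
proof -
  obtain B where B: "B \<in> ncpoly_image p" "B $ 1 $ 2 \<noteq> 0"
  proof (cases "A $ 1 $ 2 = 0")
    case False
    then show ?thesis using that assms by blast
  next
    case upper: True
    show ?thesis
    proof (cases "A $ 2 $ 1 = 0")
      case False
      then have "(flip ** A ** flip) $ 1 $ 2 \<noteq> 0" by (simp add: flip_conjugate_nth)
      then show ?thesis using that image_conjugate[OF assms(1) flip_mult_flip flip_mult_flip] by blast
    next
      case True
      define g h :: "'k^2^2" where "g = matrix2 1 1 0 1" and "h = matrix2 1 (- 1) 0 1"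
      have "h ** g = mat 1" "g ** h = mat 1"
        by (simp_all add: g_def h_def matrix2_eq_iff matrix2_mult_nth mat2_nth)
      moreover have "(g ** A ** h) $ 1 $ 2 = A $ 2 $ 2 - A $ 1 $ 1"
        using upper True by (simp add: g_def h_def matrix2_mult_nth)
      then have "(g ** A ** h) $ 1 $ 2 \<noteq> 0" using assms(2) upper True by (simp add: scalar_matrices_iff)
      ultimately show ?thesis using that image_conjugate[OF assms(1)] by blast
    qed
  qed
  obtain b where "B = ncpoly_eval b p" using B by (auto simp: ncpoly_image_def)
  with B obtain r s where rs: "(ncpoly_eval (\<lambda>i. matrix_unit (r i) (s i)) p :: 'k^2^2) $ 1 $ 2 \<noteq> 0"
    using functional_nonzero_at_matrix_units[of "\<lambda>A. A $ 1 $ 2" b] by (auto simp: mat_times_nth)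
  define u where "u = (\<lambda>i. matrix_unit (r i) (s i) :: 'k^2^2)"
  define w where "w = (\<lambda>i. flip ** u i ** flip)"
  obtain d where d: "homogeneous d (ncpoly_eval u p)"
    "\<And>R. \<exists>e. even (e - d) \<and> homogeneous e (ncpoly_eval (override_on u w R) p)"
    using homogeneous_flip_cube[of r s] unfolding u_def w_def by blast
  have u12: "ncpoly_eval u p $ 1 $ 2 \<noteq> 0" using rs by (simp add: u_def)
  then have "d = 1" using d(1) by (auto simp: homogeneous_iff)
  then have u21: "ncpoly_eval u p $ 2 $ 1 = 0" using d(1) by (auto simp: homogeneous_iff)
  show ?thesis
  proof (rule plane_subset_image[of _ _ u w])
    fix R
    obtain e where "even (e - 1)" "homogeneous e (ncpoly_eval (override_on u w R) p)"
      using d(2) \<open>d = 1\<close> by blast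
    then show "ncpoly_eval (override_on u w R) p \<in> coordinate_plane 2 1"
      by (auto simp: homogeneous_iff coordinate_plane_def)
  next
    have "ncpoly_eval w p $ 2 $ 1 = ncpoly_eval u p $ 1 $ 2"
      unfolding w_def eval_flip by (rule flip_conjugate_nth)
    then show "ncpoly_eval u p $ 1 $ 2 * ncpoly_eval w p $ 2 $ 1 \<noteq>
      ncpoly_eval u p $ 2 $ 1 * ncpoly_eval w p $ 1 $ 2"
      using u12 u21 by simp
  qed simp
qed

lemma nonscalar_traceless_in_image:
  assumes "coordinate_plane 2 1 \<subseteq> ncpoly_image p" "B \<notin> scalar_matrices" "trace B = 0"
  shows "B \<in> ncpoly_image p"
proof (rule image_nonscalar)
  show "matrix2 0 (- det B) 1 0 \<in> ncpoly_image p"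
    using assms(1) by (auto simp: coordinate_plane_def)
  show "matrix2 0 (- det B) 1 0 \<notin> scalar_matrices"
    by (simp add: scalar_matrices_iff)
  show "trace (matrix2 0 (- det B) 1 0) = trace B"
    using assms(3) by (simp add: trace_2)
  show "det (matrix2 0 (- det B) 1 0) = det B"
    by (simp add: det_2)
qed (rule assms(2))

text \<open>
  The flip of an assignment with value \<open>diag \<alpha> \<beta>\<close> has the value \<open>diag \<beta> \<alpha>\<close>. These are independent
  unless \<open>\<alpha> = \<beta>\<close> or \<open>\<alpha> = - \<beta>\<close>; the hypothesis excludes \<open>\<alpha> = - \<beta> \<noteq> \<beta>\<close>.
\<close>

lemma scalars_from_diagonal_value:
  fixes r s :: "nat \<Rightarrow> 2"
  defines "u \<equiv> \<lambda>i. matrix_unit (r i) (s i) :: 'k^2^2"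
  assumes nonzero: "ncpoly_eval u p $ 1 $ 1 \<noteq> 0 \<or> ncpoly_eval u p $ 2 $ 2 \<noteq> 0"
    and no_sign: "ncpoly_eval u p $ 1 $ 1 + ncpoly_eval u p $ 2 $ 2 = 0 \<Longrightarrow>
      ncpoly_eval u p $ 1 $ 1 = ncpoly_eval u p $ 2 $ 2"
  shows "scalar_matrices \<subseteq> ncpoly_image p"
proof -
  define w where "w = (\<lambda>i. flip ** u i ** flip)"
  obtain d where d: "homogeneous d (ncpoly_eval u p)"
    "\<And>R. \<exists>e. even (e - d) \<and> homogeneous e (ncpoly_eval (override_on u w R) p)"
    using homogeneous_flip_cube[of r s] unfolding u_def w_def by blast
  have "d = 0" using nonzero d(1) by (auto simp: homogeneous_iff)
  show ?thesis
  proof (cases "ncpoly_eval u p $ 1 $ 1 = ncpoly_eval u p $ 2 $ 2")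
    case True
    have F: "ncpoly_eval u p \<in> scalar_matrices"
      using True d(1) \<open>d = 0\<close> by (simp add: homogeneous_iff scalar_matrices_iff)
    show ?thesis
    proof
      fix B :: "'k^2^2" assume B: "B \<in> scalar_matrices"
      have "B = mat (B $ 1 $ 1 / ncpoly_eval u p $ 1 $ 1) ** ncpoly_eval u p"
        using B F nonzero by (auto simp: scalar_matrices_iff matrix2_eq_iff mat_times_nth)
      also have "\<dots> \<in> ncpoly_image p" by (rule image_scale) (auto simp: ncpoly_image_def)
      finally show "B \<in> ncpoly_image p" .
    qed
  next
    case False
    have "coordinate_plane 1 2 \<subseteq> ncpoly_image p"
    proof (rule plane_subset_image[of _ _ u w])
      fix R
      obtain e where "even e" "homogeneous e (ncpoly_eval (override_on u w R) p)"
        using d(2)[of R] \<open>d = 0\<close> by auto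
      then show "ncpoly_eval (override_on u w R) p \<in> coordinate_plane 1 2"
        by (auto simp: homogeneous_iff coordinate_plane_def)
    next
      have w: "ncpoly_eval w p $ 1 $ 1 = ncpoly_eval u p $ 2 $ 2"
          "ncpoly_eval w p $ 2 $ 2 = ncpoly_eval u p $ 1 $ 1"
        unfolding w_def eval_flip by (rule flip_conjugate_nth)+
      have "(ncpoly_eval u p $ 1 $ 1 + ncpoly_eval u p $ 2 $ 2) *
          (ncpoly_eval u p $ 1 $ 1 - ncpoly_eval u p $ 2 $ 2) \<noteq> 0"
        using False no_sign by auto
      then show "ncpoly_eval u p $ 1 $ 1 * ncpoly_eval w p $ 2 $ 2 \<noteq>
          ncpoly_eval u p $ 2 $ 2 * ncpoly_eval w p $ 1 $ 1"
        unfolding w by (auto simp: algebra_simps)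
    qed simp
    then show ?thesis by (auto simp: coordinate_plane_def scalar_matrices_iff)
  qed
qed

lemma scalars_subset_image_if_trace:
  assumes "A \<in> ncpoly_image p" "trace A \<noteq> 0"
  shows "scalar_matrices \<subseteq> ncpoly_image p"
proof -
  obtain a where "A = ncpoly_eval a p" using assms by (auto simp: ncpoly_image_def)
  then obtain r s where "trace (ncpoly_eval (\<lambda>i. matrix_unit (r i) (s i)) p :: 'k^2^2) \<noteq> 0"
    using functional_nonzero_at_matrix_units[of trace a] assms
    by (auto simp: trace_2 mat_times_nth algebra_simps)
  then show ?thesis
    by (intro scalars_from_diagonal_value[of r s]) (auto simp: trace_2)
qed

lemma scalars_subset_image_if_char2:
  assumes "(1 :: 'k) + 1 = 0" "A \<in> ncpoly_image p" "A $ 1 $ 1 \<noteq> 0"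
  shows "scalar_matrices \<subseteq> ncpoly_image p"
proof -
  obtain a where "A = ncpoly_eval a p" using assms by (auto simp: ncpoly_image_def)
  then obtain r s where rs: "(ncpoly_eval (\<lambda>i. matrix_unit (r i) (s i)) p :: 'k^2^2) $ 1 $ 1 \<noteq> 0"
    using functional_nonzero_at_matrix_units[of "\<lambda>A. A $ 1 $ 1" a] assms
    by (auto simp: mat_times_nth)
  have "x = y" if "x + y = 0" for x y :: 'k
  proof -
    have "y + y = (1 + 1) * y" by (simp only: distrib_right mult_1)
    then have "y + y = 0" using assms(1) by simp
    with that show ?thesis by (metis add_right_cancel)
  qed
  then show ?thesis
    using rs by (intro scalars_from_diagonal_value[of r s]) auto
qed

text \<open>
  A nonzero scalar matrix has trace \<open>0\<close> only in characteristic two, where it is reached through the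
  nonscalar traceless value \<open>matrix2 1 1 (-1) (-1)\<close>, whose diagonal does not vanish.
\<close>

lemma sl2_subset_image:
  assumes "A \<in> ncpoly_image p" "A \<notin> scalar_matrices"
  shows "sl2 \<subseteq> ncpoly_image p"
proof
  fix B :: "'k^2^2" assume "B \<in> sl2"
  then have tr: "trace B = 0" by (simp add: sl2_def)
  note antidiagonal = antidiagonal_subset_image[OF assms]
  show "B \<in> ncpoly_image p"
  proof (cases "B \<in> scalar_matrices")
    case False
    then show ?thesis using nonscalar_traceless_in_image[OF antidiagonal] tr by blast
  next
    case True
    show ?thesis
    proof (cases "B = 0")
      case True
      then show ?thesis using zero_in_image by simp
    next
      case False
      then have "B $ 1 $ 1 \<noteq> 0" "(1 + 1) * B $ 1 $ 1 = 0"
        using True tr by (auto simp: scalar_matrices_iff trace_2 matrix2_eq_iff distrib_right simp del: one_add_one)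
      then have char2: "(1 :: 'k) + 1 = 0" by (metis mult_eq_0_iff)
      have "matrix2 1 1 (- 1) (- 1) \<in> ncpoly_image p"
        by (rule nonscalar_traceless_in_image[OF antidiagonal])
          (simp_all add: scalar_matrices_iff trace_2)
      then have "scalar_matrices \<subseteq> ncpoly_image p"
        by (rule scalars_subset_image_if_char2[OF char2]) simp
      then show ?thesis using True by blast
    qed
  qed
qed

lemma image_trichotomy:
  "ncpoly_image p = {0} \<or> ncpoly_image p = scalar_matrices \<or> sl2 \<subseteq> ncpoly_image p"
proof (cases "ncpoly_image p \<subseteq> scalar_matrices")
  case False
  then show ?thesis using sl2_subset_image by blast
next
  case True
  show ?thesis
  proof (cases "ncpoly_image p = {0}")
    case False
    then obtain A where A: "A \<in> ncpoly_image p" "A \<noteq> 0" using zero_in_image by blast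
    have "B \<in> ncpoly_image p" if "B \<in> scalar_matrices" for B
    proof -
      have "B = mat (B $ 1 $ 1 / A $ 1 $ 1) ** A"
        using that A True by (auto simp: scalar_matrices_iff matrix2_eq_iff mat_times_nth subset_iff)
      then show ?thesis using image_scale[OF A(1)] by metis
    qed
    then show ?thesis using True by blast
  qed simp
qed

end

section \<open>Real matrices\<close>

lemma word_eval_polynomial:
  fixes a :: "real \<Rightarrow> nat \<Rightarrow> real^'n^'n"
  assumes "\<And>i k l. real_polynomial_function (\<lambda>t. a t i $ k $ l)"
  shows "real_polynomial_function (\<lambda>t. word_eval (a t) (Word_Monoid xs) $ k $ l)"
proof (induction xs arbitrary: k l)
  case Nil
  then show ?case by (simp add: word_eval_def real_polynomial_function.intros(2))
next
  case (Cons x xs)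
  have "(\<lambda>t. word_eval (a t) (Word_Monoid (x # xs)) $ k $ l) =
      (\<lambda>t. \<Sum>j\<in>UNIV. a t x $ k $ j * word_eval (a t) (Word_Monoid xs) $ j $ l)"
    by (simp add: word_eval_Cons matrix_matrix_mult_def)
  then show ?case
    using assms Cons by (simp add: real_polynomial_function_sum real_polynomial_function.intros(4))
qed

lemma eval_polynomial:
  fixes a :: "real \<Rightarrow> nat \<Rightarrow> real^'n^'n"
  assumes "\<And>i k l. real_polynomial_function (\<lambda>t. a t i $ k $ l)"
  shows "real_polynomial_function (\<lambda>t. ncpoly_eval (a t) p $ k $ l)"
proof -
  have "real_polynomial_function (\<lambda>t. word_eval (a t) w $ k $ l)" for w
    using word_eval_polynomial[OF assms, where xs = "letters w"] by simp
  then show ?thesis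
    by (simp add: ncpoly_eval_def mat_times_nth real_polynomial_function_sum
        real_polynomial_function.intros(4) real_polynomial_function.intros(2))
qed

lemma real_polynomial_function_finite_zeros:
  fixes f :: "real \<Rightarrow> real"
  assumes "real_polynomial_function f" "f t\<^sub>0 \<noteq> 0"
  shows "finite {t. f t = 0}"
proof -
  obtain c n where f: "f = (\<lambda>x. \<Sum>i\<le>n. c i * x ^ i)"
    using real_polynomial_function_imp_sum[OF assms(1)] by blast
  have "\<exists>i\<le>n. c i \<noteq> 0"
  proof (rule ccontr)
    assume "\<not> ?thesis"
    then have "f t\<^sub>0 = 0" by (simp add: f)
    then show False using assms(2) by simp
  qed
  then show ?thesis unfolding f by (simp add: polyfun_finite_roots)
qed

lemma real_polynomial_function_eventually_nonzero:
  fixes f :: "real \<Rightarrow> real"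
  assumes "real_polynomial_function f" "f t\<^sub>0 \<noteq> 0"
  shows "\<forall>\<^sub>F t in at 0. f t \<noteq> 0"
  using real_polynomial_function_finite_zeros[OF assms, THEN islimpt_finite, of 0]
  by (simp add: islimpt_iff_eventually)

lemma real_polynomial_function_tendsto:
  "real_polynomial_function f \<Longrightarrow> (f \<longlongrightarrow> f t) (at t)"
  using continuous_real_polymonial_function[of f t] by (simp add: continuous_within)

text \<open>
  A nonscalar matrix with nonzero trace is determined, up to conjugation and scaling, by the number
  \<open>r\<close> for which its determinant is \<open>r\<close> times its squared trace, that is, by the form below that
  vanishes at it.
\<close>

definition det_trace_form :: "real \<Rightarrow> real^2^2 \<Rightarrow> real" where
  "det_trace_form r A = det A - r * (trace A)\<^sup>2"

lemma det_trace_form_2: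
  "det_trace_form r A = A $ 1 $ 1 * A $ 2 $ 2 - A $ 1 $ 2 * A $ 2 $ 1 - r * (A $ 1 $ 1 + A $ 2 $ 2)\<^sup>2"
  by (simp add: det_trace_form_def det_2 trace_2)

text \<open>
  After rescaling \<open>B\<close> the segment from \<open>A\<close> to \<open>B\<close> has constant trace, and the form has a zero on it.
  That zero is not a scalar matrix. The form vanishes at a nonzero scalar matrix only if
  \<open>r = 1/4\<close>, and then adding scalar matrices does not change it. As \<open>A\<close> and \<open>B\<close> would be proportional
  modulo the scalar matrices, the form could not have opposite signs at them.
\<close>

lemma pencil_zero:
  fixes A B :: "real^2^2"
  assumes tr: "trace A \<noteq> 0" "trace B \<noteq> 0"
    and sign: "det_trace_form r A > 0" "det_trace_form r B < 0"
  obtains s t where "trace (mat s ** A + mat t ** B) \<noteq> 0"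
    "det_trace_form r (mat s ** A + mat t ** B) = 0" "mat s ** A + mat t ** B \<notin> scalar_matrices"
proof -
  define c where "c = trace A / trace B"
  have "c \<noteq> 0" using tr by (simp add: c_def)
  define X where "X t = mat (1 - t) ** A + mat (t * c) ** B" for t
  have trX: "trace (X t) = trace A" for t
  proof -
    have "trace (X t) = (1 - t) * trace A + t * (c * trace B)"
      by (simp add: X_def trace_2 mat_times_nth algebra_simps)
    also have "c * trace B = trace A" using tr by (simp add: c_def)
    finally show ?thesis by (simp add: algebra_simps)
  qed
  have scale: "det_trace_form r (mat k ** Y) = k\<^sup>2 * det_trace_form r Y" for k Y
    by (simp add: det_trace_form_2 mat_times_nth power2_eq_square algebra_simps)
  have ends: "X 0 = A" "X 1 = mat c ** B" by (simp_all add: X_def mat_zero)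
  have "det_trace_form r (X 1) < 0"
    using sign(2) \<open>c \<noteq> 0\<close> by (simp add: ends scale mult_pos_neg)
  moreover have "continuous_on {0..1} (\<lambda>t. det_trace_form r (X t))"
    unfolding det_trace_form_2 X_def vector_add_component mat_times_nth by (intro continuous_intros)
  ultimately obtain t where t: "0 \<le> t" "t \<le> 1" "det_trace_form r (X t) = 0"
    using IVT2'[of "\<lambda>t. det_trace_form r (X t)" 1 0 0] sign(1) ends(1) by auto
  have "X t \<notin> scalar_matrices"
  proof
    assume scalar: "X t \<in> scalar_matrices"
    define y where "y = X t $ 1 $ 1"
    have X: "X t $ 1 $ 1 = y" "X t $ 2 $ 2 = y" "X t $ 1 $ 2 = 0" "X t $ 2 $ 1 = 0"
      using scalar by (simp_all add: scalar_matrices_iff y_def)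
    have "y \<noteq> 0" using trX[of t] tr(1) by (simp add: trace_2 X)
    moreover have "y\<^sup>2 * (1 - 4 * r) = 0"
      using t(3) by (simp add: det_trace_form_2 X power2_eq_square algebra_simps)
    ultimately have r: "r = 1 / 4" by simp
    \<comment> \<open>The right-hand side depends only on \<open>Y\<close> modulo the scalar matrices.\<close>
    have form: "det_trace_form r Y = - ((Y $ 1 $ 1 - Y $ 2 $ 2) / 2)\<^sup>2 - Y $ 1 $ 2 * Y $ 2 $ 1" for Y
      by (simp add: det_trace_form_2 r power2_eq_square field_simps)
    have "(1 - t) * (A $ 1 $ 1 - A $ 2 $ 2) = - (t * c) * (B $ 1 $ 1 - B $ 2 $ 2)"
      "(1 - t) * A $ 1 $ 2 = - (t * c) * B $ 1 $ 2" "(1 - t) * A $ 2 $ 1 = - (t * c) * B $ 2 $ 1"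
      using X by (simp_all add: X_def mat_times_nth algebra_simps)
    then have "det_trace_form r (mat (1 - t) ** A) = det_trace_form r (mat (- (t * c)) ** B)"
      by (simp only: form mat_times_nth right_diff_distrib[symmetric])
    then have eq: "(1 - t)\<^sup>2 * det_trace_form r A = (t * c)\<^sup>2 * det_trace_form r B"
      by (simp add: scale)
    have "(t * c)\<^sup>2 * det_trace_form r B \<le> 0" using sign(2) by (simp add: mult_nonneg_nonpos)
    then have "(1 - t)\<^sup>2 * det_trace_form r A \<le> 0" using eq by simp
    then have "t = 1" using sign(1) by (simp add: mult_le_0_iff)
    then show False using eq sign(2) \<open>c \<noteq> 0\<close> by simp
  qed
  then show ?thesis using that[of "1 - t" "t * c"] t(3) trX[of t] tr(1) by (simp add: X_def)
qed

definition line_between :: "(nat \<Rightarrow> real^2^2) \<Rightarrow> (nat \<Rightarrow> real^2^2) \<Rightarrow> real \<Rightarrow> nat \<Rightarrow> real^2^2" where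
  "line_between a b t i = mat (1 - t) ** a i + mat t ** b i"

lemma line_between_ends: "line_between a b 0 = a" "line_between a b 1 = b"
  by (simp_all add: line_between_def fun_eq_iff mat_zero)

lemma polynomial_along_line:
  "real_polynomial_function (\<lambda>t. trace (ncpoly_eval (line_between a b t) p))"
  "real_polynomial_function (\<lambda>t. det_trace_form r (ncpoly_eval (line_between a b t) p))"
proof -
  have "real_polynomial_function (\<lambda>t::real. t)"
    by (rule real_polynomial_function.intros(1)) simp
  then have "real_polynomial_function (\<lambda>t. line_between a b t i $ k $ l)" for i k l
    unfolding line_between_def vector_add_component mat_times_nth
    by (intro real_polynomial_function.intros(2-) real_polynomial_function_diff)
  then have *: "real_polynomial_function (\<lambda>t. ncpoly_eval (line_between a b t) p $ k $ l)" for k l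
    by (rule eval_polynomial)
  show "real_polynomial_function (\<lambda>t. trace (ncpoly_eval (line_between a b t) p))"
    unfolding trace_2 by (intro real_polynomial_function.intros(2-) *)
  show "real_polynomial_function (\<lambda>t. det_trace_form r (ncpoly_eval (line_between a b t) p))"
    unfolding det_trace_form_2 power2_eq_square
    by (intro real_polynomial_function.intros(2-) real_polynomial_function_diff *)
qed

text \<open>
  Walk from an assignment where the form is positive to one where it is negative, changing one
  argument at a time. If the trace and the form were nonzero at all stations, the form would change
  sign between two consecutive ones, whose values span a pencil inside the image. Generic position
  is reached by moving all stations a little towards one assignment \<open>z\<close> where trace and form are
  nonzero: this preserves the signs at both ends, and by polynomiality only finitely many positions
  on the way to \<open>z\<close> are excluded.
\<close>

lemma nonscalar_zero_in_image:
  fixes q :: "real ncpoly"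
  assumes "multilinear_polynomial m q"
    and pos: "det_trace_form r (ncpoly_eval x q) > 0"
    and neg: "det_trace_form r (ncpoly_eval y q) < 0"
    and tr: "trace (ncpoly_eval z\<^sub>0 q :: real^2^2) \<noteq> 0"
  obtains C where "C \<in> ncpoly_image q" "C \<notin> scalar_matrices" "trace C \<noteq> 0" "det_trace_form r C = 0"
proof -
  interpret multilinear_polynomial m q by fact
  define T where "T a = trace (ncpoly_eval a q :: real^2^2)" for a
  define Q where "Q a = det_trace_form r (ncpoly_eval a q)" for a
  have T_poly: "real_polynomial_function (\<lambda>t. T (line_between a b t))" for a b
    unfolding T_def by (rule polynomial_along_line)
  have Q_poly: "real_polynomial_function (\<lambda>t. Q (line_between a b t))" for a b
    unfolding Q_def by (rule polynomial_along_line)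
  \<comment> \<open>On the line from \<open>z\<^sub>0\<close> to \<open>x\<close> the trace is nonzero at one end and the form at the other.\<close>
  obtain z where z: "T z \<noteq> 0" "Q z \<noteq> 0"
  proof -
    have "\<forall>\<^sub>F t in at 0. T (line_between z\<^sub>0 x t) \<noteq> 0"
      using T_poly by (rule real_polynomial_function_eventually_nonzero[of _ 0])
        (use tr in \<open>simp add: line_between_ends T_def\<close>)
    moreover have "\<forall>\<^sub>F t in at 0. Q (line_between z\<^sub>0 x t) \<noteq> 0"
      using Q_poly by (rule real_polynomial_function_eventually_nonzero[of _ 1])
        (use pos in \<open>simp add: line_between_ends Q_def\<close>)
    ultimately have "\<forall>\<^sub>F t in at 0. T (line_between z\<^sub>0 x t) \<noteq> 0 \<and> Q (line_between z\<^sub>0 x t) \<noteq> 0"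
      by (rule eventually_conj)
    then show ?thesis using that eventually_happens'[OF at_neq_bot] by blast
  qed
  define H where "H k = line_between (override_on x y {1..k}) z" for k
  have H_nonzero: "\<forall>\<^sub>F t in at 0. \<forall>k\<in>{..m}. T (H k t) \<noteq> 0 \<and> Q (H k t) \<noteq> 0"
  proof (rule eventually_ball_finite)
    show "\<forall>k\<in>{..m}. \<forall>\<^sub>F t in at 0. T (H k t) \<noteq> 0 \<and> Q (H k t) \<noteq> 0"
      unfolding H_def
      using real_polynomial_function_eventually_nonzero[OF T_poly, of _ _ 1]
        real_polynomial_function_eventually_nonzero[OF Q_poly, of _ _ 1] z
      by (auto simp: line_between_ends intro!: eventually_conj)
  qed simp
  have Q_lim: "((\<lambda>t. Q (H k t)) \<longlongrightarrow> Q (override_on x y {1..k})) (at 0)" for k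
    using real_polynomial_function_tendsto[OF Q_poly, of "override_on x y {1..k}" z 0]
    by (simp add: H_def line_between_ends)
  have "ncpoly_eval (override_on x y {1..m}) q = (ncpoly_eval y q :: real^2^2)"
    by (rule eval_cong) simp
  then have "Q (override_on x y {1..m}) < 0" using neg by (simp add: Q_def)
  then have Q_end: "\<forall>\<^sub>F t in at 0. Q (H m t) < 0" using order_tendstoD(2)[OF Q_lim] by blast
  have "Q (override_on x y {1..0}) > 0" using pos by (simp add: Q_def)
  then have Q_start: "\<forall>\<^sub>F t in at 0. Q (H 0 t) > 0" using order_tendstoD(1)[OF Q_lim] by blast
  obtain t where t: "\<And>k. k \<le> m \<Longrightarrow> T (H k t) \<noteq> 0" "\<And>k. k \<le> m \<Longrightarrow> Q (H k t) \<noteq> 0"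
      "Q (H 0 t) > 0" "Q (H m t) < 0"
    using eventually_happens'[OF at_neq_bot eventually_conj[OF H_nonzero eventually_conj[OF Q_start Q_end]]]
    by auto
  have "\<exists>k<m. Q (H k t) > 0 \<and> Q (H (Suc k) t) < 0"
  proof (rule ccontr)
    assume no_change: "\<not> ?thesis"
    have "Q (H k t) > 0" if "k \<le> m" for k
      using that
    proof (induction k)
      case (Suc k)
      then show ?case using no_change t(2)[of "Suc k"] by force
    qed (use t in simp)
    then show False using t(4) by force
  qed
  then obtain k where k: "k < m" "Q (H k t) > 0" "Q (H (Suc k) t) < 0" by blast
  obtain s s' where C: "trace (mat s ** ncpoly_eval (H k t) q + mat s' ** ncpoly_eval (H (Suc k) t) q) \<noteq> 0"
    "det_trace_form r (mat s ** ncpoly_eval (H k t) q + mat s' ** ncpoly_eval (H (Suc k) t) q) = 0"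
    "mat s ** ncpoly_eval (H k t) q + mat s' ** ncpoly_eval (H (Suc k) t) q \<notin> scalar_matrices"
    using pencil_zero t(1)[of k] t(1)[of "Suc k"] k unfolding Q_def T_def by (metis Suc_leI less_imp_le)
  have step: "H (Suc k) t = (H k t)(Suc k := H (Suc k) t (Suc k))"
    by (auto simp: H_def line_between_def override_on_def fun_eq_iff)
  have "ncpoly_eval ((H k t)(Suc k := mat s ** H k t (Suc k) + mat s' ** H (Suc k) t (Suc k))) q =
      mat s ** ncpoly_eval (H k t) q + mat s' ** ncpoly_eval (H (Suc k) t) q"
    using k by (subst eval_linear) (simp_all flip: step)
  then have "mat s ** ncpoly_eval (H k t) q + mat s' ** ncpoly_eval (H (Suc k) t) q \<in> ncpoly_image q"
    unfolding ncpoly_image_def mem_Collect_eq by metis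
  then show ?thesis using that C by blast
qed

lemma real_image_UNIV:
  fixes q :: "real ncpoly"
  assumes "multilinear_polynomial m q" "sl2 \<subseteq> ncpoly_image q"
    and "Z \<in> ncpoly_image q" "trace Z \<noteq> 0"
  shows "ncpoly_image q = UNIV"
proof -
  interpret multilinear_polynomial m q by fact
  have "matrix2 0 (- 1) 1 0 \<in> sl2" "matrix2 1 0 0 (- 1) \<in> sl2"
    by (simp_all add: sl2_def trace_2)
  then obtain x y where xy: "ncpoly_eval x q = matrix2 0 (- 1) 1 0" "ncpoly_eval y q = matrix2 1 0 0 (- 1)"
    using assms(2) unfolding ncpoly_image_def by (smt (verit) mem_Collect_eq subset_iff)
  obtain z where z: "Z = ncpoly_eval z q" using assms(3) by (auto simp: ncpoly_image_def)
  have "A \<in> ncpoly_image q" for A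
  proof (cases "A \<in> scalar_matrices \<or> trace A = 0")
    case True
    then show ?thesis using scalars_subset_image_if_trace[OF assms(3,4)] assms(2) by (auto simp: sl2_def)
  next
    case False
    define r where "r = det A / (trace A)\<^sup>2"
    \<comment> \<open>On traceless matrices the form is the determinant, which is \<open>1\<close> at \<open>x\<close> and \<open>-1\<close> at \<open>y\<close>.\<close>
    obtain C where C: "C \<in> ncpoly_image q" "C \<notin> scalar_matrices" "trace C \<noteq> 0" "det_trace_form r C = 0"
      by (rule nonscalar_zero_in_image[OF assms(1), of r x y z])
        (use assms(4) z in \<open>auto simp: xy det_trace_form_2\<close>)
    define c where "c = trace A / trace C"
    have "c \<noteq> 0" using False C by (simp add: c_def)
    have "det C = r * (trace C)\<^sup>2" using C(4) by (simp add: det_trace_form_def)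
    then have "c\<^sup>2 * det C = det A"
      using False C(3) by (simp add: c_def r_def field_simps)
    then have "det (mat c ** C) = det A"
      by (simp add: det_2 mat_times_nth power2_eq_square algebra_simps)
    moreover have "c * trace C = trace A" using C(3) by (simp add: c_def)
    then have "trace (mat c ** C) = trace A" by (simp add: trace_2 mat_times_nth algebra_simps)
    moreover have "mat c ** C \<notin> scalar_matrices"
      using C(2) \<open>c \<noteq> 0\<close> by (simp add: scalar_matrices_iff mat_times_nth)
    ultimately show ?thesis using image_nonscalar[OF image_scale[OF C(1)]] False by blast
  qed
  then show ?thesis by blast
qed

section \<open>The classification\<close>

theorem theorem1:
  fixes m :: nat and p :: "'k::field ncpoly" and q :: "real ncpoly"
  assumes "m \<ge> 1"
  shows "(p \<in> free_algebra m \<and> multilinear_poly m p \<longrightarrow>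
            ncpoly_image p = {0} \<or> ncpoly_image p = scalar_matrices \<or> sl2 \<subseteq> ncpoly_image p) \<and>
         (q \<in> free_algebra m \<and> multilinear_poly m q \<longrightarrow>
            ncpoly_image q = {0} \<or> ncpoly_image q = scalar_matrices \<or>
            ncpoly_image q = sl2 \<or> ncpoly_image q = UNIV)"
proof (intro conjI impI)
  assume "p \<in> free_algebra m \<and> multilinear_poly m p"
  then interpret multilinear_polynomial m p by unfold_locales (use assms in auto)
  show "ncpoly_image p = {0} \<or> ncpoly_image p = scalar_matrices \<or> sl2 \<subseteq> ncpoly_image p"
    by (rule image_trichotomy)
next
  assume "q \<in> free_algebra m \<and> multilinear_poly m q"
  then interpret multilinear_polynomial m q by unfold_locales (use assms in auto)
  show "ncpoly_image q = {0} \<or> ncpoly_image q = scalar_matrices \<or>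
            ncpoly_image q = sl2 \<or> ncpoly_image q = UNIV"
  proof (cases "sl2 \<subseteq> ncpoly_image q \<and> ncpoly_image q \<noteq> sl2")
    case True
    then obtain Z where "Z \<in> ncpoly_image q" "trace Z \<noteq> 0" by (auto simp: sl2_def)
    then show ?thesis using real_image_UNIV[OF multilinear_polynomial_axioms] True by blast
  next
    case False
    then show ?thesis using image_trichotomy by blast
  qed
qed

end
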